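(* Let $p\le n$ be positive integers, let $G\in\mathbb{H}^{n\times n}$ be Hermitian positive definite, and let $\mathbb{H}^{n\times p}\ni X\mapsto M_X\in\mathrm{Her}(n)$ be a smooth map such that $M_X$ is positive definite for every $X$. Equip $\mathbb{H}^{n\times p}$ with the Riemannian metric $\langle\xi,\eta\rangle_X=\mathrm{Re}(\mathrm{tr}(\xi^HM_X\eta))$. Let $X\in\mathrm{St}_G(p,\mathbb{H}^n)=\{X\in\mathbb{H}^{n\times p}\mid X^HGX=I_p\}$. Then the orthogonal projection $P_X^{M_X}:\mathbb{H}^{n\times p}\to T_X\mathrm{St}_G(p,\mathbb{H}^n)$ onto the tangent space at $X$ (orthogonal with respect to $\langle\cdot,\cdot\rangle_X$) is given, for $Y\in\mathbb{H}^{n\times p}$, by $$P_X^{M_X}(Y)=Y-M_X^{-1}GXS,$$ where $S\in\mathrm{Her}(p)$ is the solution to the Sylvester equation $$\mathrm{her}(X^HGM_X^{-1}GXS)=\mathrm{her}(X^HGY).$$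
   Context: $\mathbb{H}$ denotes the quaternions $q=q_0+q_1i+q_2j+q_3k$ with conjugate $\bar q=q_0-q_1i-q_2j-q_3k$ and real part $\mathrm{Re}(q)=q_0$; for a quaternionic matrix $A$, $A^H=\bar A^{\top}$ is the conjugate transpose. $\mathrm{Her}(n)=\{A\in\mathbb{H}^{n\times n}\mid A^H=A\}$; $A\in\mathrm{Her}(n)$ is positive definite if $x^HAx>0$ for every nonzero $x\in\mathbb{H}^n$. For a square quaternionic matrix $A$, $\mathrm{her}(A)=(A+A^H)/2$. $\mathbb{H}^{n\times p}$ is regarded as a real vector space of dimension $4np$ via $A_0+A_1i+A_2j+A_3k\mapsto(A_0,A_1,A_2,A_3)\in(\mathbb{R}^{n\times p})^4$, and $\mathrm{St}_G(p,\mathbb{H}^n)$ is regarded as a real embedded submanifold of it, whose tangent space at $X$ is $T_X\mathrm{St}_G(p,\mathbb{H}^n)=\{\xi\in\mathbb{H}^{n\times p}\mid\xi^HGX+X^HG\xi=0\}$. *)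

theory Defs
  imports "HOL-Analysis.Analysis"
begin

section \<open>Quaternions\<close>

codatatype quat = Quat (qRe: real) (qI: real) (qJ: real) (qK: real)

lemma quat_eqI [intro?]:
  "qRe x = qRe y \<Longrightarrow> qI x = qI y \<Longrightarrow> qJ x = qJ y \<Longrightarrow> qK x = qK y \<Longrightarrow> x = y"
  by (rule quat.expand) simp

lemma quat_eq_iff:
  "x = y \<longleftrightarrow> qRe x = qRe y \<and> qI x = qI y \<and> qJ x = qJ y \<and> qK x = qK y"
  by (auto intro: quat.expand)

instantiation quat :: ab_group_add
begin

primcorec zero_quat where
  "qRe 0 = 0" | "qI 0 = 0" | "qJ 0 = 0" | "qK 0 = 0"

primcorec plus_quat where
  "qRe (x + y) = qRe x + qRe y"
| "qI (x + y) = qI x + qI y"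
| "qJ (x + y) = qJ x + qJ y"
| "qK (x + y) = qK x + qK y"

primcorec uminus_quat where
  "qRe (- x) = - qRe x"
| "qI (- x) = - qI x"
| "qJ (- x) = - qJ x"
| "qK (- x) = - qK x"

primcorec minus_quat where
  "qRe (x - y) = qRe x - qRe y"
| "qI (x - y) = qI x - qI y"
| "qJ (x - y) = qJ x - qJ y"
| "qK (x - y) = qK x - qK y"

instance
  by standard (simp_all add: quat_eq_iff)

end

instantiation quat :: real_div_algebra
begin

primcorec one_quat where
  "qRe 1 = 1" | "qI 1 = 0" | "qJ 1 = 0" | "qK 1 = 0"

primcorec times_quat where
  "qRe (x * y) = qRe x * qRe y - qI x * qI y - qJ x * qJ y - qK x * qK y"
| "qI (x * y) = qRe x * qI y + qI x * qRe y + qJ x * qK y - qK x * qJ y"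
| "qJ (x * y) = qRe x * qJ y - qI x * qK y + qJ x * qRe y + qK x * qI y"
| "qK (x * y) = qRe x * qK y + qI x * qJ y - qJ x * qI y + qK x * qRe y"

primcorec scaleR_quat where
  "qRe (scaleR r x) = r * qRe x"
| "qI (scaleR r x) = r * qI x"
| "qJ (scaleR r x) = r * qJ x"
| "qK (scaleR r x) = r * qK x"

primcorec inverse_quat where
  "qRe (inverse x) = qRe x / ((qRe x)\<^sup>2 + (qI x)\<^sup>2 + (qJ x)\<^sup>2 + (qK x)\<^sup>2)"
| "qI (inverse x) = - qI x / ((qRe x)\<^sup>2 + (qI x)\<^sup>2 + (qJ x)\<^sup>2 + (qK x)\<^sup>2)"
| "qJ (inverse x) = - qJ x / ((qRe x)\<^sup>2 + (qI x)\<^sup>2 + (qJ x)\<^sup>2 + (qK x)\<^sup>2)"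
| "qK (inverse x) = - qK x / ((qRe x)\<^sup>2 + (qI x)\<^sup>2 + (qJ x)\<^sup>2 + (qK x)\<^sup>2)"

definition "x div y = x * inverse y" for x y :: quat

instance
proof
  fix x y z :: quat and a b :: real
  show "x * y * z = x * (y * z)"
    by (rule quat_eqI; simp only: times_quat.sel; algebra)
  show "(x + y) * z = x * z + y * z" "x * (y + z) = x * y + x * z"
    by (rule quat_eqI; simp add: distrib_left distrib_right)+
  show "1 * x = x" "x * 1 = x" "(0::quat) \<noteq> 1"
    by (simp_all add: quat_eq_iff)
  show "a *\<^sub>R (x + y) = a *\<^sub>R x + a *\<^sub>R y" "(a + b) *\<^sub>R x = a *\<^sub>R x + b *\<^sub>R x"
    by (rule quat_eqI; simp add: distrib_left distrib_right)+
  show "a *\<^sub>R b *\<^sub>R x = (a * b) *\<^sub>R x" "1 *\<^sub>R x = x"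
    by (simp_all add: quat_eq_iff)
  show "a *\<^sub>R x * y = a *\<^sub>R (x * y)" "x * a *\<^sub>R y = a *\<^sub>R (x * y)"
    by (rule quat_eqI; simp only: times_quat.sel scaleR_quat.sel; algebra)+
  show "x div y = x * inverse y" by (rule divide_quat_def)
  show "inverse (0::quat) = 0" by (simp add: quat_eq_iff)
  assume "x \<noteq> 0"
  define N where "N = (qRe x)\<^sup>2 + (qI x)\<^sup>2 + (qJ x)\<^sup>2 + (qK x)\<^sup>2"
  define c where "c = Quat (qRe x) (- qI x) (- qJ x) (- qK x)"
  have "N \<noteq> 0"
    using \<open>x \<noteq> 0\<close> unfolding N_def by (simp add: quat_eq_iff add_nonneg_eq_0_iff)
  have inv: "inverse x = (1/N) *\<^sub>R c"
    by (rule quat_eqI) (simp_all add: N_def c_def)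
  have "x * c = N *\<^sub>R 1" "c * x = N *\<^sub>R 1"
    by (rule quat_eqI; simp add: N_def c_def power2_eq_square)+
  then have c: "qRe (x * c) = N" "qI (x * c) = 0" "qJ (x * c) = 0" "qK (x * c) = 0"
    "qRe (c * x) = N" "qI (c * x) = 0" "qJ (c * x) = 0" "qK (c * x) = 0"
    by simp_all
  have "x * (1/N) *\<^sub>R c = (1/N) *\<^sub>R (x * c)" "(1/N) *\<^sub>R c * x = (1/N) *\<^sub>R (c * x)"
    by (rule quat_eqI; simp only: times_quat.sel scaleR_quat.sel; algebra)+
  then show "inverse x * x = 1" "x * inverse x = 1"
    using c \<open>N \<noteq> 0\<close> unfolding inv quat_eq_iff
    by (simp_all only: scaleR_quat.sel one_quat.sel c) simp_all
qed

end

definition qi :: quat where "qi = Quat 0 1 0 0"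
definition qj :: quat where "qj = Quat 0 0 1 0"
definition qk :: quat where "qk = Quat 0 0 0 1"

lemma quat_unit_mult:
  "qi * qi = - 1" "qj * qj = - 1" "qk * qk = - 1"
  "qi * qj = qk" "qj * qk = qi" "qk * qi = qj"
  "qj * qi = - qk" "qk * qj = - qi" "qi * qk = - qj"
  by (simp_all add: quat_eq_iff qi_def qj_def qk_def)

lemma quat_expand:
  "q = of_real (qRe q) + of_real (qI q) * qi + of_real (qJ q) * qj + of_real (qK q) * qk"
  by (simp add: quat_eq_iff qi_def qj_def qk_def of_real_def)

instantiation quat :: real_inner
begin

definition inner_quat :: "quat \<Rightarrow> quat \<Rightarrow> real" where
  "inner_quat x y = qRe x * qRe y + qI x * qI y + qJ x * qJ y + qK x * qK y"

definition norm_quat :: "quat \<Rightarrow> real" where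
  "norm_quat x = sqrt (inner x x)"

definition sgn_quat :: "quat \<Rightarrow> quat" where
  "sgn_quat x = x /\<^sub>R norm x"

definition dist_quat :: "quat \<Rightarrow> quat \<Rightarrow> real" where
  "dist_quat x y = norm (x - y)"

definition uniformity_quat :: "(quat \<times> quat) filter" where
  "uniformity_quat = (INF e\<in>{0 <..}. principal {(x, y). dist x y < e})"

definition open_quat :: "quat set \<Rightarrow> bool" where
  "open_quat U \<longleftrightarrow> (\<forall>x\<in>U. eventually (\<lambda>(x', y). x' = x \<longrightarrow> y \<in> U) uniformity)"

instance
proof
  fix x y z :: quat and r :: real and U :: "quat set"
  show "dist x y = norm (x - y)" by (rule dist_quat_def)
  show "sgn x = x /\<^sub>R norm x" by (rule sgn_quat_def)
  show "(uniformity :: (quat \<times> quat) filter) = (INF e\<in>{0 <..}. principal {(x, y). dist x y < e})"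
    by (rule uniformity_quat_def)
  show "open U \<longleftrightarrow> (\<forall>x\<in>U. eventually (\<lambda>(x', y). x' = x \<longrightarrow> y \<in> U) uniformity)"
    by (rule open_quat_def)
  show "inner x y = inner y x"
    unfolding inner_quat_def by (simp add: mult.commute)
  show "inner (x + y) z = inner x z + inner y z"
    unfolding inner_quat_def by (simp add: distrib_right)
  show "inner (scaleR r x) y = r * inner x y"
    unfolding inner_quat_def by (simp add: distrib_left)
  show "0 \<le> inner x x"
    unfolding inner_quat_def by simp
  show "inner x x = 0 \<longleftrightarrow> x = 0"
    unfolding inner_quat_def by (simp add: quat_eq_iff add_nonneg_eq_0_iff)
  show "norm x = sqrt (inner x x)" by (rule norm_quat_def)
qed

end

instance quat :: real_normed_div_algebra
proof
  fix x y :: quat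
  have "inner (x * y) (x * y) = inner x x * inner y y"
    unfolding inner_quat_def times_quat.sel by algebra
  then show "norm (x * y) = norm x * norm y"
    by (simp only: norm_quat_def real_sqrt_mult)
qed

instantiation quat :: euclidean_space
begin

definition Basis_quat :: "quat set" where
  "Basis_quat = {1, qi, qj, qk}"

instance
proof
  fix u v x :: quat
  show "(Basis :: quat set) \<noteq> {}" "finite (Basis :: quat set)"
    by (simp_all add: Basis_quat_def)
  show "(\<forall>u\<in>Basis. inner x u = 0) \<longleftrightarrow> x = 0"
    unfolding Basis_quat_def inner_quat_def quat_eq_iff[of x]
    by (simp add: qi_def qj_def qk_def)
  have "(1::quat) \<noteq> qi" "(1::quat) \<noteq> qj" "(1::quat) \<noteq> qk" "qi \<noteq> qj" "qi \<noteq> qk" "qj \<noteq> qk"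
    unfolding quat_eq_iff by (simp_all add: qi_def qj_def qk_def)
  moreover assume "u \<in> Basis" "v \<in> Basis"
  then have "u = 1 \<or> u = qi \<or> u = qj \<or> u = qk" "v = 1 \<or> v = qi \<or> v = qj \<or> v = qk"
    by (simp_all add: Basis_quat_def)
  ultimately show "inner u v = (if u = v then 1 else 0)"
    by (elim disjE) (simp_all only: inner_quat_def, simp_all add: qi_def qj_def qk_def)
qed

end

primcorec qcnj :: "quat \<Rightarrow> quat" where
  "qRe (qcnj q) = qRe q"
| "qI (qcnj q) = - qI q"
| "qJ (qcnj q) = - qJ q"
| "qK (qcnj q) = - qK q"


section \<open>Quaternionic matrices\<close>

text \<open>
  An \<open>n \<times> p\<close> matrix over the quaternions has type \<open>quat^'p^'n\<close>. The library product \<open>**\<close>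
  keeps the order of the factors in every entry, as needed over a noncommutative ring, and
  the real normed space structure of \<open>quat^'p^'n\<close> is the componentwise one of
  real dimension \<open>4np\<close>.
\<close>

definition adj :: "quat^'p^'n \<Rightarrow> quat^'n^'p" where
  "adj A = transpose (map_matrix qcnj A)"

definition Her :: "(quat^'n^'n) set" where
  "Her = {A. adj A = A}"

definition her :: "quat^'n^'n \<Rightarrow> quat^'n^'n" where
  "her A = (1/2) *\<^sub>R (A + adj A)"

text \<open>
  For quaternions, \<open>q > 0\<close> means that \<open>q\<close> is a positive real number.
\<close>

definition posdef :: "quat^'n^'n \<Rightarrow> bool" where
  "posdef A \<longleftrightarrow> A \<in> Her \<and>
     (\<forall>x. x \<noteq> 0 \<longrightarrow> (\<exists>r>0. (\<Sum>i\<in>UNIV. qcnj (x $ i) * (A *v x) $ i) = of_real r))"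


section \<open>Smooth maps, the Stiefel manifold and orthogonal projections\<close>

text \<open>
  \<open>C_k k f\<close> says that \<open>f\<close> is \<open>k\<close> times continuously differentiable on the whole space, the
  derivatives being taken over the reals: in finite dimension \<open>f\<close> is of class
  \<open>C\<^sup>k\<^sup>+\<^sup>1\<close> iff it is differentiable and all its directional derivatives are of class \<open>C\<^sup>k\<close>.
\<close>

primrec C_k :: "nat \<Rightarrow> ('a::euclidean_space \<Rightarrow> 'b::euclidean_space) \<Rightarrow> bool" where
  "C_k 0 f \<longleftrightarrow> continuous_on UNIV f"
| "C_k (Suc k) f \<longleftrightarrow> (\<forall>x. f differentiable (at x)) \<and>
     (\<forall>v. C_k k (\<lambda>x. frechet_derivative f (at x) v))"

definition smooth :: "('a::euclidean_space \<Rightarrow> 'b::euclidean_space) \<Rightarrow> bool" where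
  "smooth f \<longleftrightarrow> (\<forall>k. C_k k f)"

definition stiefel :: "quat^'n^'n \<Rightarrow> (quat^'p^'n) set" where
  "stiefel G = {X. adj X ** G ** X = mat 1}"

definition stiefel_tangent :: "quat^'n^'n \<Rightarrow> quat^'p^'n \<Rightarrow> (quat^'p^'n) set" where
  "stiefel_tangent G X = {\<xi>. adj \<xi> ** G ** X + adj X ** G ** \<xi> = 0}"

definition metric_at ::
  "(quat^'p^'n \<Rightarrow> quat^'n^'n) \<Rightarrow> quat^'p^'n \<Rightarrow> quat^'p^'n \<Rightarrow> quat^'p^'n \<Rightarrow> real" where
  "metric_at M X \<xi> \<eta> = qRe (trace (adj \<xi> ** M X ** \<eta>))"

definition is_orth_proj ::
  "('a::real_vector \<Rightarrow> 'a \<Rightarrow> real) \<Rightarrow> 'a set \<Rightarrow> ('a \<Rightarrow> 'a) \<Rightarrow> bool" where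
  "is_orth_proj ip T P \<longleftrightarrow> (\<forall>Y. P Y \<in> T \<and> (\<forall>\<eta>\<in>T. ip (Y - P Y) \<eta> = 0))"

text \<open>
  Meaningful only where the projection exists and is unique.
\<close>

definition orth_proj ::
  "('a::real_vector \<Rightarrow> 'a \<Rightarrow> real) \<Rightarrow> 'a set \<Rightarrow> 'a \<Rightarrow> 'a" where
  "orth_proj ip T = (THE P. is_orth_proj ip T P)"

end

theory Submission
  imports Defs
begin

text \<open>
  Write \<open>W\<close> for the inverse of \<open>M X\<close> and \<open>B = G X\<close>. The componentwise inner product on
  quaternionic matrices is \<open>Re tr (A\<^sup>H C)\<close>, so the metric at \<open>X\<close> is \<open>\<langle>\<xi>, M X \<eta>\<rangle>\<close>, left
  multiplication by \<open>A\<close> has the adjoint \<open>A\<^sup>H\<close>, and Hermitian matrices are orthogonal to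
  skew-Hermitian ones. The tangent space is the kernel of the real-linear map
  \<open>\<xi> \<mapsto> her (B\<^sup>H \<xi>)\<close>.

  A matrix \<open>W B S\<close> with \<open>S\<close> Hermitian is normal to this kernel: for tangent \<open>\<eta>\<close>, its metric
  product with \<open>\<eta>\<close> is \<open>\<langle>B S, \<eta>\<rangle> = \<langle>S, B\<^sup>H \<eta>\<rangle> = \<langle>S, her (B\<^sup>H \<eta>)\<rangle> = 0\<close>. So \<open>Y - W B S\<close> is the
  projection of \<open>Y\<close> as soon as it is tangent, and tangency is literally the Sylvester
  equation \<open>her (B\<^sup>H W B S) = her (B\<^sup>H Y)\<close>. This equation has exactly one Hermitian solution
  (\<open>sylvester_unique_solution\<close>): pairing its left side with \<open>S\<close> gives \<open>\<langle>B S, W B S\<rangle>\<close>, which is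
  positive for \<open>S \<noteq> 0\<close> because \<open>W\<close> is positive definite (\<open>matrix_inv_inner_pos\<close>) and
  \<open>X\<^sup>H B\<close> is the identity, so the operator is injective on the finite-dimensional real space of
  Hermitian matrices, hence bijective there.

  Everything is done with real-linear algebra. In particular, positive definite quaternionic
  matrices are inverted by a dimension count for \<open>N \<mapsto> A N\<close>, without determinants.
\<close>

section \<open>The conjugate transpose and the real inner product of matrices\<close>

lemma qcnj_simps [simp]:
  "qcnj (qcnj q) = q" "qcnj 0 = 0"
  "qcnj (q + r) = qcnj q + qcnj r" "qcnj (a *\<^sub>R q) = a *\<^sub>R qcnj q"
  by (simp_all add: quat_eq_iff)

lemma qcnj_mult: "qcnj (q * r) = qcnj r * qcnj q"
  by (simp add: quat_eq_iff)

lemma qcnj_sum: "qcnj (sum f A) = (\<Sum>i\<in>A. qcnj (f i))"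
  by (induction A rule: infinite_finite_induct) simp_all

lemma qRe_sum: "qRe (sum f A) = (\<Sum>i\<in>A. qRe (f i))"
  by (induction A rule: infinite_finite_induct) simp_all

lemma inner_quat_eq_qRe: "inner q r = qRe (qcnj q * r)"
  by (simp add: inner_quat_def)

lemma adj_nth [simp]: "adj A $ i $ j = qcnj (A $ j $ i)"
  by (simp add: adj_def transpose_def map_matrix_def)

lemma adj_adj [simp]: "adj (adj A) = A"
  by (simp add: vec_eq_iff)

lemma adj_add: "adj (A + B) = adj A + adj B"
  by (simp add: vec_eq_iff)

lemma adj_scaleR: "adj (a *\<^sub>R A) = a *\<^sub>R adj A"
  by (simp add: vec_eq_iff)

lemma adj_mult: "adj (A ** B) = adj B ** adj (A :: quat^'m^'n)"
  by (simp add: vec_eq_iff matrix_matrix_mult_def qcnj_sum qcnj_mult)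

lemma linear_matrix_mult_right: "linear ((**) (A :: quat^'m^'n))"
  by (rule linearI) (simp_all add: matrix_add_ldistrib matrix_scalar_ac scalar_matrix_assoc)

lemma matrix_mult_zero_right: "A ** 0 = 0" for A :: "quat^'m^'n"
  by (rule linear_0[OF linear_matrix_mult_right])

text \<open>
  The trace formula brings the metric into the form \<open>\<langle>\<xi>, M X \<eta>\<rangle>\<close> with a fixed inner product, so
  that adjoints can be moved around without any commutativity of the entries.
\<close>

lemma inner_eq_qRe_trace: "inner A B = qRe (trace (adj A ** B))"
  for A B :: "quat^'p^'n"
proof -
  have "inner A B = (\<Sum>i\<in>UNIV. \<Sum>j\<in>UNIV. qRe (qcnj (A$i$j) * B$i$j))"
    by (simp only: inner_vec_def inner_quat_eq_qRe)
  also have "\<dots> = (\<Sum>j\<in>UNIV. \<Sum>i\<in>UNIV. qRe (qcnj (A$i$j) * B$i$j))"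
    by (rule sum.swap)
  also have "\<dots> = qRe (trace (adj A ** B))"
    by (simp only: trace_def matrix_matrix_mult_def vec_lambda_beta adj_nth qRe_sum)
  finally show ?thesis .
qed

lemma metric_at_eq_inner: "metric_at M X \<xi> \<eta> = inner \<xi> (M X ** \<eta>)"
  by (simp add: metric_at_def inner_eq_qRe_trace matrix_mul_assoc)

lemma inner_adj_mult: "inner (A ** B) C = inner B (adj A ** C)"
  for A :: "quat^'m^'n"
  by (simp add: inner_eq_qRe_trace adj_mult matrix_mul_assoc)

lemma inner_adj_adj: "inner (adj A) (adj B) = inner A B"
  for A B :: "quat^'p^'n"
proof -
  have "inner (adj A) (adj B) = (\<Sum>i\<in>UNIV. \<Sum>j\<in>UNIV. inner (A$j$i) (B$j$i))"
    by (simp add: inner_vec_def inner_quat_def)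
  also have "\<dots> = inner A B"
    unfolding inner_vec_def by (rule sum.swap)
  finally show ?thesis .
qed

section \<open>The Hermitian part\<close>

lemma linear_her: "linear her"
  by (rule linearI)
    (simp_all add: her_def adj_add adj_scaleR scaleR_add_right add_ac mult.commute)

lemma subspace_Her: "subspace Her"
  by (auto simp: subspace_def Her_def adj_add adj_scaleR vec_eq_iff)

lemma her_in_Her: "her A \<in> Her"
  by (simp add: Her_def her_def adj_add adj_scaleR add.commute)

text \<open>
  The map \<open>A \<mapsto> A\<^sup>H\<close> is an isometry fixing \<open>S\<close>, so \<open>A\<close> and \<open>A\<^sup>H\<close> have the same inner product
  with \<open>S\<close>.
\<close>

lemma inner_Her_her:
  assumes "S \<in> Her"
  shows "inner S (her A) = inner S A"
proof -
  have "inner S (adj A) = inner S A"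
    using inner_adj_adj[of S A] assms by (simp add: Her_def)
  then show ?thesis
    by (simp add: her_def inner_add_right)
qed

lemma stiefel_tangent_eq_her:
  assumes "G \<in> Her"
  shows "stiefel_tangent G X = {\<xi>. her (adj X ** G ** \<xi>) = 0}"
  using assms
  by (simp add: stiefel_tangent_def her_def Her_def adj_mult matrix_mul_assoc add.commute)

section \<open>Positive definite matrices\<close>

lemma posdef_imp_Her: "posdef A \<Longrightarrow> adj A = A"
  by (simp add: posdef_def Her_def)

text \<open>
  The inner product splits over the columns of \<open>Z\<close> into the quadratic form of \<open>A\<close> at each column,
  and some column of a nonzero matrix is nonzero.
\<close>

lemma posdef_inner_pos:
  fixes A :: "quat^'n^'n" and Z :: "quat^'p^'n"
  assumes "posdef A" "Z \<noteq> 0"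
  shows "inner Z (A ** Z) > 0"
proof -
  define f where "f j = qRe (\<Sum>i\<in>UNIV. qcnj (column j Z $ i) * (A *v column j Z) $ i)" for j
  have eq: "inner Z (A ** Z) = (\<Sum>j\<in>UNIV. f j)"
    by (simp only: inner_eq_qRe_trace trace_def matrix_matrix_mult_def qRe_sum f_def column_def
        matrix_vector_mult_def vec_lambda_beta adj_nth)
  have pos: "f j > 0" if nz: "column j Z \<noteq> 0" for j
  proof -
    obtain r where "r > 0"
      "(\<Sum>i\<in>UNIV. qcnj (column j Z $ i) * (A *v column j Z) $ i) = of_real r"
      using assms(1) nz by (auto simp: posdef_def)
    then show ?thesis by (simp only: f_def of_real_def scaleR_quat.sel one_quat.sel)
  qed
  have nonneg: "f j \<ge> 0" for j
  proof (cases "column j Z = 0")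
    case True
    then show ?thesis by (simp only: f_def True) (simp add: qRe_sum)
  next
    case False
    then show ?thesis using pos[of j] by simp
  qed
  obtain j where "column j Z \<noteq> 0"
    using assms(2) by (auto simp: vec_eq_iff column_def)
  then have "(\<Sum>j\<in>UNIV. f j) > 0"
    using pos nonneg by (intro sum_pos2[where i = j]) auto
  then show ?thesis by (simp add: eq)
qed

text \<open>
  Positivity makes \<open>N \<mapsto> A N\<close> injective on square matrices, hence surjective by finite real
  dimension. A preimage of the identity is a right inverse of \<open>A\<close>, and cancelling \<open>A\<close> on the
  left in \<open>A B A = A\<close> shows that it is a left inverse.
\<close>

lemma posdef_invertible:
  fixes A :: "quat^'n^'n"
  assumes "posdef A"
  shows "invertible A"
proof -
  have inj: "inj ((**) A :: quat^'n^'n \<Rightarrow> quat^'n^'n)"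
    unfolding linear_injective_0[OF linear_matrix_mult_right]
    by (metis posdef_inner_pos[OF assms] inner_zero_right less_irrefl)
  then have "surj ((**) A :: quat^'n^'n \<Rightarrow> quat^'n^'n)"
    using linear_injective_imp_surjective[OF linear_matrix_mult_right] by blast
  then obtain B where B: "A ** B = mat 1"
    using surjD[of "(**) A" "mat 1"] by metis
  have "A ** (B ** A) = A ** mat 1"
    by (simp add: matrix_mul_assoc B)
  then have "B ** A = mat 1"
    by (rule injD[OF inj])
  with B show ?thesis
    by (auto simp: invertible_def)
qed

lemma posdef_matrix_inv:
  fixes A :: "quat^'n^'n"
  assumes "posdef A"
  shows "A ** matrix_inv A = mat 1" "matrix_inv A ** A = mat 1"
proof -
  have "A ** matrix_inv A = mat 1 \<and> matrix_inv A ** A = mat 1"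
    using posdef_invertible[OF assms] unfolding invertible_def matrix_inv_def by (rule someI_ex)
  then show "A ** matrix_inv A = mat 1" "matrix_inv A ** A = mat 1" by auto
qed

text \<open>
  For \<open>Z = A U\<close> positivity is inherited from \<open>A\<close>: \<open>\<langle>Z, A\<^sup>-\<^sup>1 Z\<rangle> = \<langle>A U, U\<rangle>\<close>.
\<close>

lemma matrix_inv_inner_pos:
  fixes A :: "quat^'n^'n" and Z :: "quat^'p^'n"
  assumes "posdef A" "Z \<noteq> 0"
  shows "inner Z (matrix_inv A ** Z) > 0"
proof -
  define U where "U = matrix_inv A ** Z"
  have Z: "Z = A ** U"
    by (simp add: U_def matrix_mul_assoc posdef_matrix_inv[OF assms(1)])
  then have "U \<noteq> 0"
    using assms(2) matrix_mult_zero_right[of A] by metis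
  then have "inner U (A ** U) > 0"
    by (rule posdef_inner_pos[OF assms(1)])
  then show ?thesis
    unfolding Z[symmetric] by (simp add: U_def inner_commute)
qed

section \<open>The Sylvester equation\<close>

text \<open>
  On Hermitian \<open>S\<close>, positivity excludes a kernel of \<open>S \<mapsto> her (K S)\<close>, because pairing with \<open>S\<close>
  does not see the skew-Hermitian part of \<open>K S\<close>. This map sends the Hermitian matrices to
  themselves, so injectivity gives bijectivity by dimension.
\<close>

lemma sylvester_unique_solution:
  fixes K :: "quat^'p^'p"
  assumes pos: "\<And>S. S \<in> Her \<Longrightarrow> S \<noteq> 0 \<Longrightarrow> inner S (K ** S) > 0"
  shows "\<exists>!S. S \<in> Her \<and> her (K ** S) = her C"
proof -
  define L where "L S = her (K ** S)" for S
  have lin: "linear L"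
    unfolding L_def
    using linear_compose[OF linear_matrix_mult_right linear_her] by (simp add: o_def)
  have inj: "inj_on L Her"
    unfolding linear_injective_on_subspace_0[OF lin subspace_Her]
  proof (intro ballI impI)
    fix S assume S: "S \<in> Her" and "L S = 0"
    then have "inner S (K ** S) = 0"
      using inner_Her_her[OF S, of "K ** S"] by (simp add: L_def)
    then show "S = 0" using pos[OF S] by force
  qed
  have "L ` Her = Her"
  proof (rule subspace_dim_equal)
    show "subspace (L ` Her)"
      using lin subspace_Her by (rule linear_subspace_image)
    show "L ` Her \<subseteq> Her"
      by (auto simp: L_def her_in_Her)
    have "span Her = (Her :: (quat^'p^'p) set)"
      using subspace_Her by (simp add: span_eq_iff)
    then show "dim (L ` Her) \<ge> dim (Her :: (quat^'p^'p) set)"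
      using dim_image_eq[OF lin, of Her] inj by (metis order_refl)
  qed (rule subspace_Her)
  then obtain S where S: "S \<in> Her" "L S = her C"
    using her_in_Her[of C] by (metis imageE)
  have "S' = S" if "S' \<in> Her \<and> L S' = her C" for S'
    using inj_onD[OF inj, of S' S] that S by simp
  moreover have "S \<in> Her \<and> L S = her C"
    using S by simp
  ultimately have "\<exists>!S. S \<in> Her \<and> L S = her C"
    by (rule ex1I[rotated])
  then show ?thesis
    by (simp only: L_def)
qed

section \<open>The orthogonal projection\<close>

text \<open>
  The difference of the two values lies in \<open>T\<close> and is orthogonal to itself.
\<close>

lemma is_orth_proj_unique:
  assumes sub: "subspace T"
    and diff: "\<And>x y z. ip (x - y) z = ip x z - ip y z"
    and pos: "\<And>x. x \<noteq> 0 \<Longrightarrow> ip x x > 0"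
    and P: "is_orth_proj ip T P" and Q: "is_orth_proj ip T Q"
  shows "P = Q"
proof
  fix Y
  have "P Y - Q Y \<in> T"
    using P Q subspace_diff[OF sub] by (simp add: is_orth_proj_def)
  then have "ip (Y - Q Y) (P Y - Q Y) = 0" "ip (Y - P Y) (P Y - Q Y) = 0"
    using P Q by (auto simp: is_orth_proj_def)
  then have "ip (P Y - Q Y) (P Y - Q Y) = 0"
    by (simp add: diff)
  then show "P Y = Q Y"
    using pos[of "P Y - Q Y"] by force
qed

theorem proposition4:
  fixes G :: "quat^'n^'n"
    and M :: "quat^'p^'n \<Rightarrow> quat^'n^'n"
    and X :: "quat^'p^'n"
  assumes "CARD('p) \<le> CARD('n)"
    and "posdef G"
    and "smooth M"
    and "\<And>Z. posdef (M Z)"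
    and "X \<in> stiefel G"
  shows "(\<exists>!P. is_orth_proj (metric_at M X) (stiefel_tangent G X) P) \<and>
    (\<forall>Y. \<exists>!S. S \<in> Her \<and>
        her (adj X ** G ** matrix_inv (M X) ** G ** X ** S) = her (adj X ** G ** Y)) \<and>
    (\<forall>Y S. S \<in> Her \<and>
        her (adj X ** G ** matrix_inv (M X) ** G ** X ** S) = her (adj X ** G ** Y) \<longrightarrow>
      orth_proj (metric_at M X) (stiefel_tangent G X) Y = Y - matrix_inv (M X) ** G ** X ** S)"
proof -
  define W where "W = matrix_inv (M X)"
  let ?T = "stiefel_tangent G X" and ?ip = "metric_at M X"
  let ?K = "adj X ** G ** W ** G ** X"
  have G: "adj G = G" and XGX: "adj X ** G ** X = mat 1"
    using assms(2,5) by (auto simp: posdef_imp_Her stiefel_def)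
  have T: "?T = {\<xi>. her (adj X ** G ** \<xi>) = 0}"
    using G by (intro stiefel_tangent_eq_her) (simp add: Her_def)
  have lin: "linear (\<lambda>\<xi>. her (adj X ** G ** \<xi>))"
    using linear_compose[OF linear_matrix_mult_right linear_her] by (simp add: o_def)

  have sylvester: "\<exists>!S. S \<in> Her \<and> her (?K ** S) = her (adj X ** G ** Y)" for Y
  proof (rule sylvester_unique_solution)
    fix S :: "quat^'p^'p" assume "S \<noteq> 0"
    \<comment> \<open>The constraint on \<open>X\<close> enters here: it gives \<open>G X\<close> the left inverse \<open>X\<^sup>H\<close>.\<close>
    have "S = adj X ** (G ** X ** S)"
      by (simp add: matrix_mul_assoc XGX)
    with \<open>S \<noteq> 0\<close> have "G ** X ** S \<noteq> 0"
      using matrix_mult_zero_right[of "adj X"] by metis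
    then have "inner (G ** X ** S) (W ** (G ** X ** S)) > 0"
      unfolding W_def by (intro matrix_inv_inner_pos assms(4))
    moreover have "inner (G ** X ** S) (W ** (G ** X ** S)) = inner S (?K ** S)"
      unfolding inner_adj_mult by (simp add: adj_mult G matrix_mul_assoc)
    ultimately show "inner S (?K ** S) > 0" by simp
  qed

  have tangent: "Y - W ** G ** X ** S \<in> ?T"
    if "her (?K ** S) = her (adj X ** G ** Y)" for Y S
    using that by (simp add: T linear_diff[OF lin] matrix_mul_assoc)

  have normal: "?ip (W ** G ** X ** S) \<eta> = 0" if S: "S \<in> Her" and \<eta>: "\<eta> \<in> ?T" for S \<eta>
  proof -
    have "?ip (W ** G ** X ** S) \<eta> = inner (M X ** (W ** G ** X ** S)) \<eta>"
      by (simp add: metric_at_eq_inner inner_adj_mult posdef_imp_Her[OF assms(4)])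
    also have "\<dots> = inner (G ** X ** S) \<eta>"
      by (simp add: W_def matrix_mul_assoc posdef_matrix_inv[OF assms(4)])
    also have "\<dots> = inner S (adj X ** G ** \<eta>)"
      by (simp add: inner_adj_mult adj_mult G)
    also have "\<dots> = inner S (her (adj X ** G ** \<eta>))"
      by (simp add: inner_Her_her[OF S])
    also have "\<dots> = 0"
      using \<eta> by (simp add: T)
    finally show ?thesis .
  qed

  define sol where
    "sol Y = (THE S. S \<in> Her \<and> her (?K ** S) = her (adj X ** G ** Y))" for Y
  define P where "P Y = Y - W ** G ** X ** sol Y" for Y
  have sol: "sol Y \<in> Her" "her (?K ** sol Y) = her (adj X ** G ** Y)" for Y
    using theI'[OF sylvester[of Y]] by (auto simp: sol_def)
  have P: "is_orth_proj ?ip ?T P"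
    unfolding is_orth_proj_def P_def using tangent normal sol by auto
  have unique: "Q = P" if "is_orth_proj ?ip ?T Q" for Q
  proof (rule is_orth_proj_unique[OF _ _ _ that P])
    show "subspace ?T"
      unfolding T using lin by (rule linear_subspace_kernel)
    show "?ip (\<xi> - \<zeta>) \<eta> = ?ip \<xi> \<eta> - ?ip \<zeta> \<eta>" for \<xi> \<zeta> \<eta>
      by (simp add: metric_at_eq_inner inner_diff_left)
    show "?ip \<xi> \<xi> > 0" if "\<xi> \<noteq> 0" for \<xi>
      using posdef_inner_pos[OF assms(4) that] by (simp add: metric_at_eq_inner)
  qed
  have orth_proj: "orth_proj ?ip ?T = P"
    unfolding orth_proj_def using P unique by (rule the_equality)
  have "orth_proj ?ip ?T Y = Y - W ** G ** X ** S"
    if "S \<in> Her \<and> her (?K ** S) = her (adj X ** G ** Y)" for Y S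
  proof -
    have "sol Y = S"
      unfolding sol_def using sylvester[of Y] that by (rule the1_equality)
    then show ?thesis by (simp add: orth_proj P_def)
  qed
  moreover have "\<exists>!P. is_orth_proj ?ip ?T P"
    using P unique by (rule ex1I)
  ultimately show ?thesis
    using sylvester unfolding W_def by (intro conjI allI impI)
qed

end
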